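(* Let $\mathcal{M} = (\mathcal{S},\mathcal{A},\Psi,\mathcal{R},p)$ be the MDP of the multi-period newsvendor problem with discount factor $\gamma=0$, let $\mathcal{M}'' = (\mathcal{S},\mathcal{A}',\Psi',\mathcal{R}',p'')$ be the MDP obtained from it by reward shaping and relabeling of actions as defined in the context, and let $\sim = (\sim_{\mathcal{S}},\sim_{\Psi'})$ with $$\sim_{\mathcal{S}} = \mathcal{S}\times\mathcal{S},\qquad \sim_{\Psi'} = \{((s_1,a_1),(s_2,a_2))\in\Psi'\times\Psi'\mid a_1=a_2\}.$$ Then $\sim$ is a simple visible symmetry of $\mathcal{M}''$, the MDPs $\mathcal{M}$ and $\mathcal{M}''$ are equivalent, and hence $(\mathcal{M}'',\sim)$ is a hidden symmetry of $\mathcal{M}$.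
   Context: **MDPs.** A Markov decision process (MDP) is a tuple $(\mathcal{S}, \mathcal{A}, \Psi, \mathcal{R}, p)$ where $\mathcal{S}$ is a countable set of states, $\mathcal{A}$ is a set of actions, $\Psi \subseteq \mathcal{S}\times\mathcal{A}$ is the set of admissible state-action pairs such that $\mathcal{A}(s) = \{a \in \mathcal{A} \mid (s,a)\in\Psi\}$ is nonempty and finite for every $s$, $\mathcal{R}\subseteq\mathbb{R}$ is a bounded set of rewards, and $p\colon \mathcal{S}\times\mathcal{R}\times\Psi\to[0,1]$, written $p(s',r\mid s,a)$, satisfies $\sum_{s'\in\mathcal{S}, r\in\mathcal{R}} p(s',r\mid s,a) = 1$ for all $(s,a)\in\Psi$. Put $p(s'\mid s,a) = \sum_{r\in\mathcal{R}} p(s',r\mid s,a)$. A policy is a map $\pi\colon\Psi\to[0,1]$, written $\pi(a\mid s)$, with $\sum_{a\in\mathcal{A}(s)}\pi(a\mid s)=1$ for all $s$. The discount factor is $0$, so the value function is $V_\pi(s) = \mathbb{E}_{\pi,p}[R_1\mid S_0=s]$, the expected first reward when starting in $s$ and following $\pi$. A policy $\pi$ is optimal if $V_\pi(s) = \sup_{\tilde\pi}V_{\tilde\pi}(s)$ for all $s\in\mathcal{S}$, the supremum being over all policies. **Visible symmetry.** A visible symmetry of an MDP is a pair $\sim = (\sim_{\mathcal{S}},\sim_\Psi)$ of equivalence relations on $\mathcal{S}$ and on $\Psi$ such that (i) for all $(s_1,a_1)\in\Psi$ and $s_2\in\mathcal{S}$ with $s_1\sim_{\mathcal{S}}s_2$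 there is $a_2\in\mathcal{A}(s_2)$ with $(s_1,a_1)\sim_\Psi(s_2,a_2)$; and (ii) whenever $(s_1,a_1)\sim_\Psi(s_2,a_2)$, then $s_1\sim_{\mathcal{S}}s_2$ and $\sum_{\tilde s\in X}p(\tilde s,r\mid s_1,a_1) = \sum_{\tilde s\in X}p(\tilde s,r\mid s_2,a_2)$ for all classes $X\in\mathcal{S}/\!\sim_{\mathcal{S}}$ and all $r\in\mathcal{R}$. It is simple if $(s_1,a_1)\sim_\Psi(s_2,a_2)$ implies $a_1=a_2$. **Equivalence and hidden symmetry.** A relabeling of $(\mathcal{S},\mathcal{A},\Psi,\mathcal{R},p)$ to $(\hat{\mathcal{S}},\hat{\mathcal{A}},\hat\Psi,\mathcal{R},\hat p)$ (same reward set) consists of bijections $f\colon\mathcal{S}\to\hat{\mathcal{S}}$ and $g_s\colon\mathcal{A}(s)\to\hat{\mathcal{A}}(f(s))$, $s\in\mathcal{S}$, with $p(\tilde s,r\mid s,a) = \hat p(f(\tilde s),r\mid f(s),g_s(a))$ for all $(s,a)\in\Psi$, $\tilde s\in\mathcal{S}$, $r\in\mathcal{R}$; the second MDP is then a relabeled variant of the first. Two MDPs with the same states, actions and admissible pairs have the same transition structure if their state transition probabilities $p(s'\mid s,a)$ agree for all $(s,a)\in\Psi$, $s'\in\mathcal{S}$. MDPs $\mathcal{N}$ and $\mathcal{N}'$ are equivalent if (1) $\mathcal{N}'$ is a relabeled variant of $\mathcal{N}$; or (2) they have the same transition structure and the same optimal policies; or (3) some relabeled variant of $\mathcal{N}$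 has the same transition structure and the same optimal policies as $\mathcal{N}'$; or (4) $\mathcal{N}'$ is a relabeled variant of some MDP having the same transition structure and the same optimal policies as $\mathcal{N}$. $(\mathcal{N}',\sim)$ is a hidden symmetry of $\mathcal{N}$ if $\mathcal{N}$ and $\mathcal{N}'$ are equivalent and $\sim$ is a visible symmetry of $\mathcal{N}'$. **Multi-period newsvendor problem.** Data: i.i.d. integer-valued bounded random variables $(\delta_t)_{t\in\mathbb{N}_0}$ (deviations) whose set of possible values is $\mathbb{Z}_\delta\subseteq\mathbb{Z}$; natural numbers $F_t$, $t \in \mathbb{N}_0$ (forecasts), such that there is a constant $C$ with $0\le F_t+\delta_t<C$ for all $t$; real numbers $0<C_p<C_s$. For $a\in F_t+\mathbb{Z}_\delta$ and $d\in\mathbb{Z}_\delta$ let $\operatorname{Rew}_t(a,d) = \min\{F_t+d,a\}C_s - aC_p$; the same formula is used for $a=F_t$. The MDP $\mathcal{M} = (\mathcal{S},\mathcal{A},\Psi,\mathcal{R},p)$ has states $\mathcal{S} = \{s_t\mid t\in\mathbb{N}_0\}$ (pairwise distinct), $\mathcal{A}(s_t) = F_t+\mathbb{Z}_\delta$, $\mathcal{A} = \bigcup_{s\in\mathcal{S}}\mathcal{A}(s)$, $\Psi = \{(s,a)\mid s\in\mathcal{S}, a\in\mathcal{A}(s)\}$, $\mathcal{R} = \bigcup_{t\in\mathbb{N}_0}\operatorname{Rew}_t(F_t+\mathbb{Z}_\delta,\mathbb{Z}_\delta)$, and $p(s_l,r\mid s_t,a) = \sum_{d\in\mathbb{Z}_\delta,\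 r=\operatorname{Rew}_t(a,d)}\Pr\{\delta_t=d\}$ if $l=t+1$ and $0$ otherwise. As in the deterministic case (where $\delta_t=0$), the policy $\pi_*^{\det}(s_t)=F_t$ is regarded as a policy in $\mathcal{M}$, so $0\in\mathbb{Z}_\delta$. **Transformed MDPs.** $\mathcal{M}' = (\mathcal{S},\mathcal{A},\Psi,\mathcal{R}',p')$ has $\mathcal{R}' = \{r_1-r_2\mid r_1,r_2\in\mathcal{R}\}$ and $p'(s_l,r\mid s_t,a) = \sum_{d\in D'(r,t,a)}\Pr\{\delta_t=d\}$ if $l=t+1$ and $0$ otherwise, where $D'(r,t,a) = \{d\in\mathbb{Z}_\delta\mid r=\operatorname{Rew}_t(a,d)-\operatorname{Rew}_t(F_t,d)\}$. $\mathcal{M}'' = (\mathcal{S},\mathcal{A}',\Psi',\mathcal{R}',p'')$ has $\mathcal{A}'=\mathcal{A}'(s_t)=\mathbb{Z}_\delta$, $\Psi'=\mathcal{S}\times\mathbb{Z}_\delta$ and $p''(s_l,r\mid s_t,a') = p'(s_l,r\mid s_t,a'+F_t)$. *)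

theory Defs
  imports "HOL-Probability.Probability"
begin

section \<open>Markov decision processes\<close>

text \<open>\<open>kernel M s' r s a\<close> is $p(s',r \mid s,a)$. It is only meaningful for \<open>s' \<in> states M\<close>,
  \<open>r \<in> rewards M\<close> and \<open>(s, a) \<in> admissible M\<close>; no definition below looks at other arguments.\<close>

record ('s, 'a) mdp =
  states :: "'s set"
  actions :: "'a set"
  admissible :: "('s \<times> 'a) set"
  rewards :: "real set"
  kernel :: "'s \<Rightarrow> real \<Rightarrow> 's \<Rightarrow> 'a \<Rightarrow> real"

definition actions_at :: "('s, 'a) mdp \<Rightarrow> 's \<Rightarrow> 'a set" where
  "actions_at M s = {a \<in> actions M. (s, a) \<in> admissible M}"

definition is_mdp :: "('s, 'a) mdp \<Rightarrow> bool" where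
  "is_mdp M \<longleftrightarrow>
     countable (states M) \<and>
     admissible M \<subseteq> states M \<times> actions M \<and>
     (\<forall>s\<in>states M. actions_at M s \<noteq> {} \<and> finite (actions_at M s)) \<and>
     bounded (rewards M) \<and>
     (\<forall>(s, a)\<in>admissible M. \<forall>s'\<in>states M. \<forall>r\<in>rewards M. kernel M s' r s a \<in> {0..1}) \<and>
     (\<forall>(s, a)\<in>admissible M.
        ((\<lambda>(s', r). kernel M s' r s a) has_sum 1) (states M \<times> rewards M))"

definition state_prob :: "('s, 'a) mdp \<Rightarrow> 's \<Rightarrow> 's \<Rightarrow> 'a \<Rightarrow> real" where
  "state_prob M s' s a = (\<Sum>\<^sub>\<infinity>r\<in>rewards M. kernel M s' r s a)"

definition policies :: "('s, 'a) mdp \<Rightarrow> ('s \<times> 'a \<Rightarrow> real) set" where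
  "policies M = {\<pi> \<in> admissible M \<rightarrow>\<^sub>E {0..1}. \<forall>s\<in>states M. (\<Sum>a\<in>actions_at M s. \<pi> (s, a)) = 1}"

definition action_pmf :: "('s, 'a) mdp \<Rightarrow> ('s \<times> 'a \<Rightarrow> real) \<Rightarrow> 's \<Rightarrow> 'a pmf" where
  "action_pmf M \<pi> s = embed_pmf (\<lambda>a. if a \<in> actions_at M s then \<pi> (s, a) else 0)"

definition step_pmf :: "('s, 'a) mdp \<Rightarrow> 's \<Rightarrow> 'a \<Rightarrow> ('s \<times> real) pmf" where
  "step_pmf M s a =
     embed_pmf (\<lambda>(s', r). if s' \<in> states M \<and> r \<in> rewards M then kernel M s' r s a else 0)"

text \<open>The value function for discount factor 0: the expectation of the first reward $R_1$, where
  $(S_1, R_1)$ is obtained from $S_0 = s$ by drawing an action from \<open>\<pi>\<close> and then a transition.\<close>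

definition val :: "('s, 'a) mdp \<Rightarrow> ('s \<times> 'a \<Rightarrow> real) \<Rightarrow> 's \<Rightarrow> real" where
  "val M \<pi> s = measure_pmf.expectation (bind_pmf (action_pmf M \<pi> s) (step_pmf M s)) snd"

text \<open>The values are bounded because the rewards of an MDP are, so the real supremum is the
  genuine one.\<close>

definition optimal :: "('s, 'a) mdp \<Rightarrow> ('s \<times> 'a \<Rightarrow> real) \<Rightarrow> bool" where
  "optimal M \<pi> \<longleftrightarrow> \<pi> \<in> policies M \<and> (\<forall>s\<in>states M. val M \<pi> s = (SUP \<pi>'\<in>policies M. val M \<pi>' s))"


section \<open>Visible and hidden symmetries\<close>

definition visible_symmetry ::
    "('s, 'a) mdp \<Rightarrow> 's rel \<times> ('s \<times> 'a) rel \<Rightarrow> bool" where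
  "visible_symmetry M = (\<lambda>(rS, rPsi).
     is_mdp M \<and> equiv (states M) rS \<and> equiv (admissible M) rPsi \<and>
     (\<forall>(s1, a1)\<in>admissible M. \<forall>s2\<in>states M. (s1, s2) \<in> rS \<longrightarrow>
        (\<exists>a2\<in>actions_at M s2. ((s1, a1), (s2, a2)) \<in> rPsi)) \<and>
     (\<forall>((s1, a1), (s2, a2))\<in>rPsi. (s1, s2) \<in> rS \<and>
        (\<forall>X\<in>states M // rS. \<forall>r\<in>rewards M.
           (\<Sum>\<^sub>\<infinity>s'\<in>X. kernel M s' r s1 a1) = (\<Sum>\<^sub>\<infinity>s'\<in>X. kernel M s' r s2 a2))))"

definition simple_visible_symmetry ::
    "('s, 'a) mdp \<Rightarrow> 's rel \<times> ('s \<times> 'a) rel \<Rightarrow> bool" where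
  "simple_visible_symmetry M sim \<longleftrightarrow>
     visible_symmetry M sim \<and> (\<forall>((s1, a1), (s2, a2))\<in>snd sim. a1 = a2)"

definition relabeling ::
    "('s \<Rightarrow> 't) \<Rightarrow> ('s \<Rightarrow> 'a \<Rightarrow> 'b) \<Rightarrow> ('s, 'a) mdp \<Rightarrow> ('t, 'b) mdp \<Rightarrow> bool" where
  "relabeling f g M N \<longleftrightarrow>
     rewards N = rewards M \<and>
     bij_betw f (states M) (states N) \<and>
     (\<forall>s\<in>states M. bij_betw (g s) (actions_at M s) (actions_at N (f s))) \<and>
     (\<forall>(s, a)\<in>admissible M. \<forall>s'\<in>states M. \<forall>r\<in>rewards M.
        kernel M s' r s a = kernel N (f s') r (f s) (g s a))"

definition relabeled_variant :: "('t, 'b) mdp \<Rightarrow> ('s, 'a) mdp \<Rightarrow> bool" where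
  "relabeled_variant N M \<longleftrightarrow> is_mdp N \<and> is_mdp M \<and> (\<exists>f g. relabeling f g M N)"

definition same_transition_structure :: "('s, 'a) mdp \<Rightarrow> ('s, 'a) mdp \<Rightarrow> bool" where
  "same_transition_structure M N \<longleftrightarrow>
     states M = states N \<and> actions M = actions N \<and> admissible M = admissible N \<and>
     (\<forall>(s, a)\<in>admissible M. \<forall>s'\<in>states M. state_prob M s' s a = state_prob N s' s a)"

definition same_optimal_policies :: "('s, 'a) mdp \<Rightarrow> ('s, 'a) mdp \<Rightarrow> bool" where
  "same_optimal_policies M N \<longleftrightarrow> {\<pi>. optimal M \<pi>} = {\<pi>. optimal N \<pi>}"

definition mdp_equivalent :: "('s, 'a) mdp \<Rightarrow> ('s, 'a) mdp \<Rightarrow> bool" where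
  "mdp_equivalent N N' \<longleftrightarrow> is_mdp N \<and> is_mdp N' \<and>
     (relabeled_variant N' N \<or>
      (same_transition_structure N N' \<and> same_optimal_policies N N') \<or>
      (\<exists>K :: ('s, 'a) mdp. relabeled_variant K N \<and>
         same_transition_structure K N' \<and> same_optimal_policies K N') \<or>
      (\<exists>K :: ('s, 'a) mdp. is_mdp K \<and>
         same_transition_structure K N \<and> same_optimal_policies K N \<and> relabeled_variant N' K))"

definition hidden_symmetry ::
    "('s, 'a) mdp \<Rightarrow> ('s, 'a) mdp \<times> ('s rel \<times> ('s \<times> 'a) rel) \<Rightarrow> bool" where
  "hidden_symmetry N = (\<lambda>(N', sim). mdp_equivalent N N' \<and> visible_symmetry N' sim)"


section \<open>The multi-period newsvendor problem\<close>

text \<open>The state $s_t$ is \<open>St t\<close>.\<close>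

datatype nv_state = St (period: nat)

definition Rew :: "(nat \<Rightarrow> nat) \<Rightarrow> real \<Rightarrow> real \<Rightarrow> nat \<Rightarrow> int \<Rightarrow> int \<Rightarrow> real" where
  "Rew F Cp Cs t a d = real_of_int (min (int (F t) + d) a) * Cs - real_of_int a * Cp"

definition prob_dev :: "'w measure \<Rightarrow> (nat \<Rightarrow> 'w \<Rightarrow> int) \<Rightarrow> nat \<Rightarrow> int \<Rightarrow> real" where
  "prob_dev \<Omega> \<delta> t d = measure \<Omega> {\<omega> \<in> space \<Omega>. \<delta> t \<omega> = d}"

definition nv_actions_at :: "int set \<Rightarrow> (nat \<Rightarrow> nat) \<Rightarrow> nat \<Rightarrow> int set" where
  "nv_actions_at Z F t = (\<lambda>d. int (F t) + d) ` Z"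

definition nv_rewards :: "int set \<Rightarrow> (nat \<Rightarrow> nat) \<Rightarrow> real \<Rightarrow> real \<Rightarrow> real set" where
  "nv_rewards Z F Cp Cs = (\<Union>t. {Rew F Cp Cs t a d | a d. a \<in> nv_actions_at Z F t \<and> d \<in> Z})"

definition newsvendor_mdp ::
    "'w measure \<Rightarrow> (nat \<Rightarrow> 'w \<Rightarrow> int) \<Rightarrow> int set \<Rightarrow> (nat \<Rightarrow> nat) \<Rightarrow> real \<Rightarrow> real \<Rightarrow> (nv_state, int) mdp" where
  "newsvendor_mdp \<Omega> \<delta> Z F Cp Cs =
     \<lparr>states = range St,
      actions = (\<Union>t. nv_actions_at Z F t),
      admissible = {(St t, a) | t a. a \<in> nv_actions_at Z F t},
      rewards = nv_rewards Z F Cp Cs,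
      kernel = (\<lambda>s' r s a.
        if period s' = period s + 1
        then \<Sum>d | d \<in> Z \<and> r = Rew F Cp Cs (period s) a d. prob_dev \<Omega> \<delta> (period s) d
        else 0)\<rparr>"

definition shaped_mdp ::
    "'w measure \<Rightarrow> (nat \<Rightarrow> 'w \<Rightarrow> int) \<Rightarrow> int set \<Rightarrow> (nat \<Rightarrow> nat) \<Rightarrow> real \<Rightarrow> real \<Rightarrow> (nv_state, int) mdp" where
  "shaped_mdp \<Omega> \<delta> Z F Cp Cs =
     \<lparr>states = states (newsvendor_mdp \<Omega> \<delta> Z F Cp Cs),
      actions = actions (newsvendor_mdp \<Omega> \<delta> Z F Cp Cs),
      admissible = admissible (newsvendor_mdp \<Omega> \<delta> Z F Cp Cs),
      rewards = {r1 - r2 | r1 r2. r1 \<in> nv_rewards Z F Cp Cs \<and> r2 \<in> nv_rewards Z F Cp Cs},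
      kernel = (\<lambda>s' r s a.
        if period s' = period s + 1
        then \<Sum>d | d \<in> Z \<and> r = Rew F Cp Cs (period s) a d
                             - Rew F Cp Cs (period s) (int (F (period s))) d.
               prob_dev \<Omega> \<delta> (period s) d
        else 0)\<rparr>"

definition relabeled_mdp ::
    "'w measure \<Rightarrow> (nat \<Rightarrow> 'w \<Rightarrow> int) \<Rightarrow> int set \<Rightarrow> (nat \<Rightarrow> nat) \<Rightarrow> real \<Rightarrow> real \<Rightarrow> (nv_state, int) mdp" where
  "relabeled_mdp \<Omega> \<delta> Z F Cp Cs =
     \<lparr>states = states (shaped_mdp \<Omega> \<delta> Z F Cp Cs),
      actions = Z,
      admissible = states (shaped_mdp \<Omega> \<delta> Z F Cp Cs) \<times> Z,
      rewards = rewards (shaped_mdp \<Omega> \<delta> Z F Cp Cs),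
      kernel = (\<lambda>s' r s a'.
        kernel (shaped_mdp \<Omega> \<delta> Z F Cp Cs) s' r s (a' + int (F (period s))))\<rparr>"

end

theory Submission
  imports Defs
begin

text \<open>
  All three newsvendor MDPs have the same shape: from \<open>s\<close> the process moves to a successor that
  depends on \<open>s\<close> alone, and the reward is a function of \<open>s\<close>, of the action \<open>a\<close> and of a random
  deviation whose law \<open>D s\<close> does not depend on \<open>a\<close>. The locale \<open>noise_driven\<close> captures
  this. With discount factor 0, the value of a policy at \<open>s\<close> is then the average, over the actions
  that the policy draws at \<open>s\<close>, of the mean payoff of these actions (\<open>val_noise_driven\<close>).

  Reward shaping subtracts from the payoff of \<open>a\<close> at $s_t$ the payoff of the action $F_t$ under the
  same deviation. Mean payoffs at $s_t$ thereby drop by a constant that depends on $t$ but not on the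
  action, so the values of all policies at $s_t$ drop by this same constant and the maximisers do
  not change (\<open>shaping_preserves_optimal_policies\<close>). The transition structure does not change either,
  since the successor is always $s_{t+1}$. Hence the newsvendor MDP and its shaped version have the same
  transition structure and the same optimal policies, and the last MDP is obtained from the shaped one by the
  relabeling of actions $a \mapsto a - F_t$. Passing first to an MDP with the same transition structure and
  the same optimal policies and then to a relabeled variant is one of the forms that equivalence may take.

  For the symmetry, write an action as $F_t + a$ and the demand as $F_t + d$. The shaped reward is then
  \[ (\min\{d, a\} - \min\{d, 0\}) C_s - a C_p, \]
  in which $F_t$ has cancelled. As the deviations are identically distributed, the relabeled MDP offers
  the same reward distribution for \<open>a\<close> in every period, and all states are interchangeable.
\<close>

section \<open>MDPs driven by exogenous noise\<close>

locale noise_driven =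
  fixes M :: "('s, 'a) mdp" and next_state :: "'s \<Rightarrow> 's"
    and R :: "'s \<Rightarrow> 'a \<Rightarrow> 'd \<Rightarrow> real" and D :: "'s \<Rightarrow> 'd pmf"
  assumes countable_states: "countable (states M)"
    and admissible_subset: "admissible M \<subseteq> states M \<times> actions M"
    and actions_at: "\<And>s. s \<in> states M \<Longrightarrow> actions_at M s \<noteq> {} \<and> finite (actions_at M s)"
    and bounded_rewards: "bounded (rewards M)"
    and next_state_in_states: "\<And>s. s \<in> states M \<Longrightarrow> next_state s \<in> states M"
    and finite_noise: "\<And>s. finite (set_pmf (D s))"
    and payoff_in_rewards:
      "\<And>s a d. (s, a) \<in> admissible M \<Longrightarrow> d \<in> set_pmf (D s) \<Longrightarrow> R s a d \<in> rewards M"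
    and kernel_eq: "\<And>s a s' r. (s, a) \<in> admissible M \<Longrightarrow> s' \<in> states M \<Longrightarrow> r \<in> rewards M \<Longrightarrow>
      kernel M s' r s a = (if s' = next_state s then pmf (map_pmf (R s a) (D s)) r else 0)"
begin

definition transition_law :: "'s \<Rightarrow> 'a \<Rightarrow> ('s \<times> real) pmf" where
  "transition_law s a = map_pmf (\<lambda>d. (next_state s, R s a d)) (D s)"

lemma set_transition_law:
  assumes "(s, a) \<in> admissible M"
  shows "set_pmf (transition_law s a) \<subseteq> states M \<times> rewards M"
  using assms admissible_subset next_state_in_states payoff_in_rewards
  by (auto simp: transition_law_def)

lemma finite_transition_law: "finite (set_pmf (transition_law s a))"
  by (simp add: transition_law_def finite_noise)

lemma pmf_transition_law:
  "pmf (transition_law s a) (s', r) = (if s' = next_state s then pmf (map_pmf (R s a) (D s)) r else 0)"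
proof -
  have "(\<lambda>d. (next_state s, R s a d)) -` {(s', r)} = (if s' = next_state s then R s a -` {r} else {})"
    by auto
  then show ?thesis
    by (simp add: transition_law_def pmf_map)
qed

lemma kernel_eq_pmf:
  assumes "(s, a) \<in> admissible M" "s' \<in> states M" "r \<in> rewards M"
  shows "kernel M s' r s a = pmf (transition_law s a) (s', r)"
  using kernel_eq[OF assms] by (simp add: pmf_transition_law)

text \<open>\<open>embed_pmf\<close> is meaningful only for functions of total mass 1. Recognising the function in
  \<open>step_pmf\<close> as the mass function of an image of the noise yields this without summing the kernel.\<close>

lemma step_pmf_eq:
  assumes "(s, a) \<in> admissible M"
  shows "step_pmf M s a = transition_law s a"
proof -
  have "(\<lambda>(s', r). if s' \<in> states M \<and> r \<in> rewards M then kernel M s' r s a else 0)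
      = pmf (transition_law s a)"
    using kernel_eq_pmf[OF assms] set_transition_law[OF assms]
    by (auto simp: fun_eq_iff set_pmf_iff)
  then show ?thesis
    by (simp add: step_pmf_def type_definition.Rep_inverse[OF td_pmf_embed_pmf])
qed

lemma kernel_has_sum_1:
  assumes "(s, a) \<in> admissible M"
  shows "((\<lambda>(s', r). kernel M s' r s a) has_sum 1) (states M \<times> rewards M)"
proof -
  let ?p = "transition_law s a"
  have "(pmf ?p has_sum 1) (set_pmf ?p)"
    by (intro has_sum_finiteI) (simp_all add: finite_transition_law sum_pmf_eq_1)
  moreover have "((\<lambda>(s', r). kernel M s' r s a) has_sum 1) (states M \<times> rewards M) \<longleftrightarrow>
      (pmf ?p has_sum 1) (set_pmf ?p)"
    using set_transition_law[OF assms]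
    by (intro has_sum_cong_neutral) (auto simp: kernel_eq_pmf[OF assms] set_pmf_iff)
  ultimately show ?thesis
    by simp
qed

lemma is_mdp: "is_mdp M"
  unfolding is_mdp_def
  using countable_states admissible_subset actions_at bounded_rewards kernel_has_sum_1
  by (auto simp: kernel_eq_pmf pmf_le_1)

lemma state_prob_eq:
  assumes "(s, a) \<in> admissible M" "s' \<in> states M"
  shows "state_prob M s' s a = (if s' = next_state s then 1 else 0)"
proof -
  let ?q = "map_pmf (R s a) (D s)"
  have sub: "set_pmf ?q \<subseteq> rewards M"
    using payoff_in_rewards[OF assms(1)] by auto
  have fin: "finite (set_pmf ?q)"
    by (simp add: finite_noise)
  have "infsum (pmf ?q) (rewards M) = infsum (pmf ?q) (set_pmf ?q)"
    using sub by (intro infsum_cong_neutral) (auto simp: pmf_eq_0_set_pmf)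
  also have "\<dots> = 1"
    using fin by (simp add: sum_pmf_eq_1 del: set_map_pmf)
  finally have "infsum (pmf ?q) (rewards M) = 1" .
  moreover have "state_prob M s' s a
      = (\<Sum>\<^sub>\<infinity>r\<in>rewards M. if s' = next_state s then pmf ?q r else 0)"
    unfolding state_prob_def by (intro infsum_cong) (simp add: kernel_eq assms)
  ultimately show ?thesis
    by simp
qed

lemma infsum_kernel_states:
  assumes "(s, a) \<in> admissible M" "r \<in> rewards M"
  shows "(\<Sum>\<^sub>\<infinity>s'\<in>states M. kernel M s' r s a) = pmf (map_pmf (R s a) (D s)) r"
proof -
  have "s \<in> states M"
    using assms(1) admissible_subset by auto
  then have "(\<Sum>\<^sub>\<infinity>s'\<in>states M. kernel M s' r s a) = (\<Sum>\<^sub>\<infinity>s'\<in>{next_state s}. kernel M s' r s a)"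
    using next_state_in_states assms
    by (intro infsum_cong_neutral) (auto simp: kernel_eq)
  then show ?thesis
    using next_state_in_states[OF \<open>s \<in> states M\<close>] assms by (simp add: kernel_eq)
qed

definition mean_payoff :: "'s \<Rightarrow> 'a \<Rightarrow> real" where
  "mean_payoff s a = measure_pmf.expectation (D s) (R s a)"

lemma actions_at_admissible: "a \<in> actions_at M s \<longleftrightarrow> (s, a) \<in> admissible M"
  using admissible_subset by (auto simp: actions_at_def)

lemma pmf_action_pmf:
  assumes "\<pi> \<in> policies M" "s \<in> states M"
  shows "pmf (action_pmf M \<pi> s) a = (if a \<in> actions_at M s then \<pi> (s, a) else 0)"
proof -
  let ?f = "\<lambda>a. if a \<in> actions_at M s then \<pi> (s, a) else 0"
  have nonneg: "0 \<le> ?f a" for a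
    using assms(1) by (auto simp: policies_def actions_at_admissible PiE_iff)
  have "(\<integral>\<^sup>+a. ennreal (?f a) \<partial>count_space UNIV) = (\<Sum>a\<in>actions_at M s. ennreal (?f a))"
    using actions_at[OF assms(2)] by (intro nn_integral_count_space') auto
  also have "\<dots> = ennreal (\<Sum>a\<in>actions_at M s. ?f a)"
    using nonneg by (intro sum_ennreal)
  also have "\<dots> = 1"
    using assms by (simp add: policies_def)
  finally show ?thesis
    unfolding action_pmf_def by (intro pmf_embed_pmf nonneg)
qed

lemma val_noise_driven:
  assumes "\<pi> \<in> policies M" "s \<in> states M"
  shows "val M \<pi> s = (\<Sum>a\<in>actions_at M s. \<pi> (s, a) * mean_payoff s a)"
proof -
  have step: "step_pmf M s a = transition_law s a" if "a \<in> actions_at M s" for a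
    using that by (simp add: step_pmf_eq actions_at_admissible)
  have "val M \<pi> s = (\<Sum>a\<in>actions_at M s. pmf (action_pmf M \<pi> s) a *\<^sub>R
      measure_pmf.expectation (step_pmf M s a) snd)"
    unfolding val_def using actions_at[OF assms(2)]
    by (intro pmf_expectation_bind)
       (auto simp: step finite_transition_law set_pmf_iff pmf_action_pmf[OF assms] split: if_splits)
  also have "\<dots> = (\<Sum>a\<in>actions_at M s. \<pi> (s, a) * mean_payoff s a)"
    by (intro sum.cong) (simp_all add: pmf_action_pmf[OF assms] step transition_law_def mean_payoff_def)
  finally show ?thesis .
qed

text \<open>Without an upper bound the real supremum in \<open>optimal\<close> would be an arbitrary number, which need
  not follow a shift of the values.\<close>

lemma bdd_above_val:
  assumes "s \<in> states M"
  shows "bdd_above ((\<lambda>\<pi>. val M \<pi> s) ` policies M)"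
proof (rule bdd_aboveI2)
  fix \<pi> assume \<pi>: "\<pi> \<in> policies M"
  have "\<pi> (s, a) * mean_payoff s a \<le> \<bar>mean_payoff s a\<bar>" if "a \<in> actions_at M s" for a
  proof -
    have "0 \<le> \<pi> (s, a)" "\<pi> (s, a) \<le> 1"
      using \<pi> that by (auto simp: policies_def actions_at_admissible PiE_iff)
    then have "\<pi> (s, a) * mean_payoff s a \<le> \<pi> (s, a) * \<bar>mean_payoff s a\<bar>"
      by (intro mult_left_mono) auto
    also have "\<dots> \<le> \<bar>mean_payoff s a\<bar>"
      using \<open>\<pi> (s, a) \<le> 1\<close> \<open>0 \<le> \<pi> (s, a)\<close> by (intro mult_left_le_one_le) auto
    finally show ?thesis .
  qed
  then show "val M \<pi> s \<le> (\<Sum>a\<in>actions_at M s. \<bar>mean_payoff s a\<bar>)"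
    unfolding val_noise_driven[OF \<pi> assms] by (intro sum_mono)
qed

text \<open>The total relation has a single class, and summing the kernel over it forgets the successor. What
  remains to be compared between two states is the law of the reward.\<close>

lemma simple_visible_symmetry_total:
  assumes adm: "admissible M = states M \<times> A"
    and homogeneous: "\<And>s1 s2 a. s1 \<in> states M \<Longrightarrow> s2 \<in> states M \<Longrightarrow> a \<in> A \<Longrightarrow>
      map_pmf (R s1 a) (D s1) = map_pmf (R s2 a) (D s2)"
  shows "simple_visible_symmetry M (states M \<times> states M,
    {((s1, a1), (s2, a2)). (s1, a1) \<in> admissible M \<and> (s2, a2) \<in> admissible M \<and> a1 = a2})"
proof -
  have quot: "X = states M" if "X \<in> states M // (states M \<times> states M)" for X
    using that by (auto simp: quotient_def)
  have "equiv (states M) (states M \<times> states M)"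
    by (auto simp: equiv_def refl_on_def sym_def trans_def)
  moreover have "equiv (admissible M)
      {((s1, a1), (s2, a2)). (s1, a1) \<in> admissible M \<and> (s2, a2) \<in> admissible M \<and> a1 = a2}"
    by (auto simp: equiv_def refl_on_def sym_def trans_def)
  moreover have "(\<Sum>\<^sub>\<infinity>s'\<in>X. kernel M s' r s1 a) = (\<Sum>\<^sub>\<infinity>s'\<in>X. kernel M s' r s2 a)"
    if "X \<in> states M // (states M \<times> states M)" "r \<in> rewards M"
      "(s1, a) \<in> admissible M" "(s2, a) \<in> admissible M" for X r s1 s2 a
    using that homogeneous[of s1 s2 a] by (simp add: quot[OF that(1)] infsum_kernel_states adm)
  ultimately show ?thesis
    unfolding simple_visible_symmetry_def visible_symmetry_def
    using is_mdp by (auto simp: actions_at_admissible) (auto simp: adm)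
qed

end

text \<open>A shift of all mean payoffs at \<open>s\<close> by the same \<open>c s\<close> shifts the value of every policy at \<open>s\<close> by
  \<open>c s\<close>, because a policy has total mass 1 at \<open>s\<close>. The supremum moves along, so the policies that
  attain it are the same.\<close>

lemma shaping_preserves_optimal_policies:
  assumes "noise_driven M next_state R D" "noise_driven M' next_state' R' D'"
    and eq: "states M' = states M" "actions M' = actions M" "admissible M' = admissible M"
    and shift: "\<And>s a. (s, a) \<in> admissible M \<Longrightarrow>
      measure_pmf.expectation (D' s) (R' s a) = measure_pmf.expectation (D s) (R s a) - c s"
  shows "same_optimal_policies M M'"
proof -
  interpret N: noise_driven M next_state R D by fact
  interpret N': noise_driven M' next_state' R' D' by fact
  have act: "actions_at M' = actions_at M"
    using eq by (simp add: actions_at_def fun_eq_iff)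
  have pol: "policies M' = policies M"
    using eq by (simp add: policies_def act)
  have val: "val M' \<pi> s = val M \<pi> s - c s" if "\<pi> \<in> policies M" "s \<in> states M" for \<pi> s
  proof -
    have "val M' \<pi> s = (\<Sum>a\<in>actions_at M s. \<pi> (s, a) * (N.mean_payoff s a - c s))"
      using that by (subst N'.val_noise_driven)
        (auto simp: pol eq act N'.mean_payoff_def N.mean_payoff_def shift N.actions_at_admissible
          intro!: sum.cong)
    also have "\<dots> = val M \<pi> s - (\<Sum>a\<in>actions_at M s. \<pi> (s, a)) * c s"
      using that by (simp add: N.val_noise_driven right_diff_distrib sum_subtractf sum_distrib_right)
    finally show ?thesis
      using that by (simp add: policies_def)
  qed
  have Sup: "(SUP \<pi>\<in>policies M. val M' \<pi> s) = (SUP \<pi>\<in>policies M. val M \<pi> s) - c s"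
    if "policies M \<noteq> {}" "s \<in> states M" for s
  proof -
    have "(SUP \<pi>\<in>policies M. val M' \<pi> s) = (SUP \<pi>\<in>policies M. val M \<pi> s - c s)"
      using that by (intro SUP_cong) (simp_all add: val)
    also have "\<dots> = (SUP \<pi>\<in>policies M. val M \<pi> s) - c s"
      using continuous_at_Sup_mono[of "\<lambda>x. x - c s" "(\<lambda>\<pi>. val M \<pi> s) ` policies M"]
        that N.bdd_above_val
      by (simp add: mono_def image_image continuous_intros)
    finally show ?thesis .
  qed
  have "optimal M \<pi> \<longleftrightarrow> optimal M' \<pi>" for \<pi>
  proof (cases "\<pi> \<in> policies M")
    case True
    then have ne: "policies M \<noteq> {}"
      by auto
    have "val M \<pi> s = (SUP \<pi>'\<in>policies M. val M \<pi>' s) \<longleftrightarrow>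
        val M' \<pi> s = (SUP \<pi>'\<in>policies M. val M' \<pi>' s)" if "s \<in> states M" for s
      using val[OF True that] Sup[OF ne that] by linarith
    then show ?thesis
      by (simp add: optimal_def pol eq)
  qed (simp add: optimal_def pol)
  then show ?thesis
    by (simp add: same_optimal_policies_def)
qed

lemma pmf_map_finite_support:
  assumes "finite Z" "set_pmf D \<subseteq> Z"
  shows "pmf (map_pmf f D) r = (\<Sum>d | d \<in> Z \<and> r = f d. pmf D d)"
proof -
  have "pmf (map_pmf f D) r = measure_pmf.prob D (f -` {r} \<inter> set_pmf D)"
    by (simp add: pmf_map measure_Int_set_pmf)
  also have "\<dots> = measure_pmf.prob D ({d. d \<in> Z \<and> r = f d} \<inter> set_pmf D)"
    using assms(2) by (intro arg_cong[where f = "measure_pmf.prob D"]) auto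
  also have "\<dots> = (\<Sum>d | d \<in> Z \<and> r = f d. pmf D d)"
    using assms(1) by (simp add: measure_Int_set_pmf measure_measure_pmf_finite)
  finally show ?thesis .
qed


section \<open>The newsvendor MDPs\<close>

locale newsvendor =
  fixes \<Omega> :: "'w measure" and \<delta> :: "nat \<Rightarrow> 'w \<Rightarrow> int" and Z :: "int set"
    and F :: "nat \<Rightarrow> nat" and Cp Cs :: real and D :: "int pmf" and C :: int
  assumes finite_Z: "finite Z" and zero_Z: "0 \<in> Z" and set_D: "set_pmf D \<subseteq> Z"
    and prob_dev_eq: "prob_dev \<Omega> \<delta> t d = pmf D d"
    and demand: "d \<in> Z \<Longrightarrow> 0 \<le> int (F t) + d \<and> int (F t) + d < C"
begin

abbreviation "M \<equiv> newsvendor_mdp \<Omega> \<delta> Z F Cp Cs"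
abbreviation "M' \<equiv> shaped_mdp \<Omega> \<delta> Z F Cp Cs"
abbreviation "M'' \<equiv> relabeled_mdp \<Omega> \<delta> Z F Cp Cs"
abbreviation "shaped_rew t a d \<equiv> Rew F Cp Cs t a d - Rew F Cp Cs t (int (F t)) d"

text \<open>Both the quantity sold and the quantity ordered are integers in the range of possible demands,
  so the infinitely many periods produce finitely many rewards in total.\<close>

lemma finite_nv_rewards: "finite (nv_rewards Z F Cp Cs)"
proof (rule finite_subset)
  show "nv_rewards Z F Cp Cs \<subseteq>
      (\<lambda>(x, a). real_of_int x * Cs - real_of_int a * Cp) ` ({0..<C} \<times> {0..<C})"
  proof
    fix r assume "r \<in> nv_rewards Z F Cp Cs"
    then obtain t e d where "e \<in> Z" "d \<in> Z" "r = Rew F Cp Cs t (int (F t) + e) d"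
      by (auto simp: nv_rewards_def nv_actions_at_def)
    then show "r \<in> (\<lambda>(x, a). real_of_int x * Cs - real_of_int a * Cp) ` ({0..<C} \<times> {0..<C})"
      using demand[of e t] demand[of d t]
      by (intro image_eqI[of _ _ "(min (int (F t) + d) (int (F t) + e), int (F t) + e)"])
         (auto simp: Rew_def)
  qed
qed simp

lemma finite_reward_differences:
  "finite {r1 - r2 | r1 r2. r1 \<in> nv_rewards Z F Cp Cs \<and> r2 \<in> nv_rewards Z F Cp Cs}"
proof (rule finite_subset)
  show "{r1 - r2 | r1 r2. r1 \<in> nv_rewards Z F Cp Cs \<and> r2 \<in> nv_rewards Z F Cp Cs}
      \<subseteq> (\<lambda>(r1, r2). r1 - r2) ` (nv_rewards Z F Cp Cs \<times> nv_rewards Z F Cp Cs)"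
    by auto
qed (simp add: finite_nv_rewards)

lemma Rew_in_nv_rewards:
  "a \<in> nv_actions_at Z F t \<Longrightarrow> d \<in> Z \<Longrightarrow> Rew F Cp Cs t a d \<in> nv_rewards Z F Cp Cs"
  by (auto simp: nv_rewards_def)

lemma forecast_action: "int (F t) \<in> nv_actions_at Z F t"
  using zero_Z by (auto simp: nv_actions_at_def)

lemma shaped_rew_in_differences:
  assumes "a \<in> nv_actions_at Z F t" "d \<in> Z"
  shows "shaped_rew t a d \<in> {r1 - r2 | r1 r2. r1 \<in> nv_rewards Z F Cp Cs \<and> r2 \<in> nv_rewards Z F Cp Cs}"
  using Rew_in_nv_rewards assms forecast_action by blast

lemma mdp_actions_at:
  "actions_at M (St t) = nv_actions_at Z F t"
  "actions_at M' (St t) = nv_actions_at Z F t"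
  "actions_at M'' (St t) = Z"
  by (auto simp: actions_at_def newsvendor_mdp_def shaped_mdp_def relabeled_mdp_def)

lemma nv_actions_at_nonempty_finite: "nv_actions_at Z F t \<noteq> {} \<and> finite (nv_actions_at Z F t)"
  using finite_Z zero_Z by (auto simp: nv_actions_at_def)

lemma period_eq_iff: "period s = t \<longleftrightarrow> s = St t"
  by (cases s) simp

lemma range_St: "range St = UNIV"
  by (metis nv_state.collapse surjI)

lemma finite_set_D: "finite (set_pmf D)"
  using finite_subset[OF set_D finite_Z] .

lemmas sum_prob_dev_eq = pmf_map_finite_support[OF finite_Z set_D]

lemma countable_nv_states: "countable (UNIV :: nv_state set)"
  by (metis range_St countable_image countableI_type)

lemma noise_driven_M:
  "noise_driven M (\<lambda>s. St (period s + 1)) (\<lambda>s. Rew F Cp Cs (period s)) (\<lambda>_. D)"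
proof
  fix s assume "s \<in> states M"
  show "actions_at M s \<noteq> {} \<and> finite (actions_at M s)"
    by (cases s) (simp add: mdp_actions_at nv_actions_at_nonempty_finite)
qed (use set_D in \<open>auto simp: newsvendor_mdp_def range_St countable_nv_states finite_set_D
       finite_nv_rewards finite_imp_bounded prob_dev_eq period_eq_iff sum_prob_dev_eq
       intro!: Rew_in_nv_rewards\<close>)

lemma noise_driven_M':
  "noise_driven M' (\<lambda>s. St (period s + 1)) (\<lambda>s. shaped_rew (period s)) (\<lambda>_. D)"
proof
  fix s assume "s \<in> states M'"
  show "actions_at M' s \<noteq> {} \<and> finite (actions_at M' s)"
    by (cases s) (simp add: mdp_actions_at nv_actions_at_nonempty_finite)
next
  fix s a d assume "(s, a) \<in> admissible M'" "d \<in> set_pmf D"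
  then show "shaped_rew (period s) a d \<in> rewards M'"
    using shaped_rew_in_differences[of a "period s" d] set_D
    by (auto simp: newsvendor_mdp_def shaped_mdp_def)
next
  show "bounded (rewards M')"
    using finite_reward_differences by (simp add: shaped_mdp_def finite_imp_bounded)
qed (auto simp: newsvendor_mdp_def shaped_mdp_def range_St countable_nv_states finite_set_D
       prob_dev_eq period_eq_iff sum_prob_dev_eq)

lemma noise_driven_M'':
  "noise_driven M'' (\<lambda>s. St (period s + 1))
     (\<lambda>s a. shaped_rew (period s) (a + int (F (period s)))) (\<lambda>_. D)"
proof
  fix s assume "s \<in> states M''"
  show "actions_at M'' s \<noteq> {} \<and> finite (actions_at M'' s)"
    using finite_Z zero_Z by (cases s) (auto simp: mdp_actions_at)
next
  fix s a d assume "(s, a) \<in> admissible M''" "d \<in> set_pmf D"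
  then have "a + int (F (period s)) \<in> nv_actions_at Z F (period s)" "d \<in> Z"
    using set_D by (auto simp: relabeled_mdp_def nv_actions_at_def)
  from shaped_rew_in_differences[OF this]
  show "shaped_rew (period s) (a + int (F (period s))) d \<in> rewards M''"
    by (simp add: relabeled_mdp_def shaped_mdp_def)
next
  show "bounded (rewards M'')"
    using finite_reward_differences
    by (simp add: relabeled_mdp_def shaped_mdp_def finite_imp_bounded)
qed (auto simp: relabeled_mdp_def newsvendor_mdp_def shaped_mdp_def range_St countable_nv_states
       finite_set_D prob_dev_eq period_eq_iff sum_prob_dev_eq)

lemma same_transition_structure_M'_M: "same_transition_structure M' M"
proof -
  interpret N: noise_driven M "\<lambda>s. St (period s + 1)" "\<lambda>s. Rew F Cp Cs (period s)" "\<lambda>_. D"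
    by (rule noise_driven_M)
  interpret N': noise_driven M' "\<lambda>s. St (period s + 1)" "\<lambda>s. shaped_rew (period s)" "\<lambda>_. D"
    by (rule noise_driven_M')
  have eq: "states M' = states M" "actions M' = actions M" "admissible M' = admissible M"
    by (simp_all add: shaped_mdp_def)
  show ?thesis
    unfolding same_transition_structure_def
    using N.state_prob_eq N'.state_prob_eq by (auto simp: eq)
qed

lemma same_optimal_policies_M'_M: "same_optimal_policies M' M"
proof -
  have "same_optimal_policies M M'"
  proof (rule shaping_preserves_optimal_policies[OF noise_driven_M noise_driven_M'])
    fix s a
    show "measure_pmf.expectation D (shaped_rew (period s) a)
        = measure_pmf.expectation D (Rew F Cp Cs (period s) a)
          - measure_pmf.expectation D (Rew F Cp Cs (period s) (int (F (period s))))"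
      by (intro Bochner_Integration.integral_diff integrable_measure_pmf_finite finite_set_D)
  qed (simp_all add: shaped_mdp_def)
  then show ?thesis
    by (simp add: same_optimal_policies_def)
qed

lemma relabeled_variant_M''_M': "relabeled_variant M'' M'"
proof -
  have "relabeling id (\<lambda>s a. a - int (F (period s))) M' M''"
    unfolding relabeling_def
  proof (intro conjI ballI)
    fix s
    show "bij_betw (\<lambda>a. a - int (F (period s))) (actions_at M' s) (actions_at M'' (id s))"
      by (cases s) (auto simp: mdp_actions_at nv_actions_at_def
          intro!: bij_betw_byWitness[where f' = "\<lambda>d. int (F (period s)) + d"])
  qed (auto simp: relabeled_mdp_def)
  then show ?thesis
    unfolding relabeled_variant_def
    using noise_driven.is_mdp[OF noise_driven_M'] noise_driven.is_mdp[OF noise_driven_M''] by blast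
qed

lemma mdp_equivalent_M_M'': "mdp_equivalent M M''"
  unfolding mdp_equivalent_def
  using noise_driven.is_mdp[OF noise_driven_M] noise_driven.is_mdp[OF noise_driven_M']
    noise_driven.is_mdp[OF noise_driven_M''] same_transition_structure_M'_M
    same_optimal_policies_M'_M relabeled_variant_M''_M'
  by blast

lemma shaped_rew_forecast_free:
  "shaped_rew t (a + int (F t)) d
    = real_of_int (min d a - min d 0) * Cs - real_of_int a * Cp"
proof -
  have "min (int (F t) + d) (a + int (F t)) = int (F t) + min d a"
    "min (int (F t) + d) (int (F t)) = int (F t) + min d 0"
    by auto
  then show ?thesis
    unfolding Rew_def by (simp add: algebra_simps)
qed

lemma simple_visible_symmetry_M'':
  "simple_visible_symmetry M'' (states M'' \<times> states M'',
    {((s1, a1), (s2, a2)). (s1, a1) \<in> admissible M'' \<and> (s2, a2) \<in> admissible M'' \<and> a1 = a2})"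
  by (rule noise_driven.simple_visible_symmetry_total[OF noise_driven_M'', of Z])
     (simp_all only: shaped_rew_forecast_free, simp add: relabeled_mdp_def)

end

text \<open>A single law \<open>D\<close> serves all periods; this is where the periods lose their individuality and
  what makes the states interchangeable.\<close>

lemma deviation_law:
  fixes \<delta> :: "nat \<Rightarrow> 'w \<Rightarrow> int"
  assumes "prob_space \<Omega>"
    and rv: "\<And>t. \<delta> t \<in> measurable \<Omega> (count_space UNIV)"
    and ident: "\<And>t. distr \<Omega> (count_space UNIV) (\<delta> t) = distr \<Omega> (count_space UNIV) (\<delta> 0)"
    and range: "\<delta> 0 ` space \<Omega> \<subseteq> Z" and "finite Z"
  obtains D where "set_pmf D \<subseteq> Z" "\<And>t d. prob_dev \<Omega> \<delta> t d = pmf D d"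
proof -
  interpret prob_space \<Omega> by fact
  let ?P = "prob_dev \<Omega> \<delta> 0"
  have distr: "prob_dev \<Omega> \<delta> t d = measure (distr \<Omega> (count_space UNIV) (\<delta> t)) {d}" for t d
    using rv by (subst measure_distr) (auto simp: prob_dev_def intro!: arg_cong[where f = prob])
  interpret X: prob_space "distr \<Omega> (count_space UNIV) (\<delta> 0)"
    using rv by (rule prob_space_distr)
  have out: "?P d = 0" if "d \<notin> Z" for d
  proof -
    have "{\<omega> \<in> space \<Omega>. \<delta> 0 \<omega> = d} = {}"
      using that range by auto
    then show ?thesis
      unfolding prob_dev_def by (simp only: measure_empty)
  qed
  have "(\<Sum>d\<in>Z. ?P d) = measure (distr \<Omega> (count_space UNIV) (\<delta> 0)) Z"
    unfolding distr using \<open>finite Z\<close> by (subst X.finite_measure_eq_sum_singleton) simp_all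
  also have "\<dots> = prob (space \<Omega>)"
    using rv range by (subst measure_distr) (auto intro!: arg_cong[where f = prob])
  finally have sum: "(\<Sum>d\<in>Z. ?P d) = 1"
    by (simp add: prob_space)
  have nonneg: "0 \<le> ?P d" for d
    by (simp add: prob_dev_def)
  have "(\<integral>\<^sup>+d. ennreal (?P d) \<partial>count_space UNIV) = (\<Sum>d\<in>Z. ennreal (?P d))"
    using \<open>finite Z\<close> out by (intro nn_integral_count_space') auto
  also have "\<dots> = 1"
    using nonneg by (subst sum_ennreal) (simp_all add: sum)
  finally have pmf: "pmf (embed_pmf ?P) d = ?P d" for d
    by (intro pmf_embed_pmf nonneg)
  show thesis
  proof
    show "set_pmf (embed_pmf ?P) \<subseteq> Z"
      using out by (metis pmf set_pmf_iff subsetI)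
    show "prob_dev \<Omega> \<delta> t d = pmf (embed_pmf ?P) d" for t d
      by (simp add: pmf distr ident[of t])
  qed
qed

theorem mainTheorem3:
  fixes \<Omega> :: "'w measure"
    and \<delta> :: "nat \<Rightarrow> 'w \<Rightarrow> int"
    and Z :: "int set"
    and F :: "nat \<Rightarrow> nat"
    and Cp Cs :: real
  assumes "prob_space \<Omega>"
    and independent: "prob_space.indep_vars \<Omega> (\<lambda>_. count_space UNIV) \<delta> UNIV"
    and identically_distributed:
      "\<And>t. distr \<Omega> (count_space UNIV) (\<delta> t) = distr \<Omega> (count_space UNIV) (\<delta> 0)"
    and bounded: "\<exists>B. \<forall>t. \<forall>\<omega>\<in>space \<Omega>. \<bar>\<delta> t \<omega>\<bar> \<le> B"
    and possible_values: "\<And>t. \<delta> t ` space \<Omega> = Z"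
    and zero_value: "0 \<in> Z"
    and demand_range: "\<exists>C. \<forall>t. \<forall>\<omega>\<in>space \<Omega>. 0 \<le> int (F t) + \<delta> t \<omega> \<and> int (F t) + \<delta> t \<omega> < C"
    and prices: "0 < Cp" "Cp < Cs"
  defines "M \<equiv> newsvendor_mdp \<Omega> \<delta> Z F Cp Cs"
    and "M'' \<equiv> relabeled_mdp \<Omega> \<delta> Z F Cp Cs"
  defines "simS \<equiv> states M'' \<times> states M''"
    and "simPsi \<equiv> {((s1, a1), (s2, a2)). (s1, a1) \<in> admissible M'' \<and> (s2, a2) \<in> admissible M'' \<and> a1 = a2}"
  shows "simple_visible_symmetry M'' (simS, simPsi) \<and>
         mdp_equivalent M M'' \<and>
         hidden_symmetry M (M'', (simS, simPsi))"
proof -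
  interpret prob_space \<Omega> by fact
  obtain B where B: "\<forall>t. \<forall>\<omega>\<in>space \<Omega>. \<bar>\<delta> t \<omega>\<bar> \<le> B"
    using bounded by auto
  have "Z \<subseteq> {-B..B}"
    using B unfolding possible_values[of 0, symmetric] by (auto simp: abs_le_iff minus_le_iff)
  then have fin: "finite Z"
    by (rule finite_subset) simp
  have rv: "\<delta> t \<in> measurable \<Omega> (count_space UNIV)" for t
    using independent by (auto simp: indep_vars_def2)
  obtain D where D: "set_pmf D \<subseteq> Z" "\<And>t d. prob_dev \<Omega> \<delta> t d = pmf D d"
    using deviation_law[of \<Omega> \<delta> Z, OF \<open>prob_space \<Omega>\<close> rv identically_distributed _ fin] possible_values[of 0]
    by blast
  obtain C where C: "\<forall>t. \<forall>\<omega>\<in>space \<Omega>. 0 \<le> int (F t) + \<delta> t \<omega> \<and> int (F t) + \<delta> t \<omega> < C"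
    using demand_range by auto
  have "0 \<le> int (F t) + d \<and> int (F t) + d < C" if "d \<in> Z" for t d
  proof -
    have "d \<in> \<delta> t ` space \<Omega>"
      using that possible_values[of t] by simp
    then obtain \<omega> where "\<omega> \<in> space \<Omega>" "\<delta> t \<omega> = d"
      by blast
    then show ?thesis
      using C by auto
  qed
  then interpret newsvendor \<Omega> \<delta> Z F Cp Cs D C
    using fin zero_value D by unfold_locales auto
  have "simple_visible_symmetry M'' (simS, simPsi)"
    unfolding M''_def simS_def simPsi_def by (rule simple_visible_symmetry_M'')
  moreover have "mdp_equivalent M M''"
    unfolding M_def M''_def by (rule mdp_equivalent_M_M'')
  ultimately show ?thesis
    by (simp add: hidden_symmetry_def simple_visible_symmetry_def)
qed

end
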